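(* Let $\Sigma\in\mathbb{R}^{p\times p}$ be a covariance matrix (positive semi-definite) with $\Sigma\neq 0$, and let $P_\Sigma=N(0,\Sigma)$. Define $\beta$ through the equation $\Phi(\sqrt{\beta})=\frac34$, where $\Phi$ is the cumulative distribution function of $N(0,1)$. Then, for any $\mathcal{U}\subset S^{p-1}$, $$\mathcal{D}_{\mathcal{U}}(\beta\Sigma,P_\Sigma)=\tfrac12 .$$
   Context: $S^{p-1}=\{u\in\mathbb{R}^p:\|u\|=1\}$ is the Euclidean unit sphere. For a probability distribution $\mathbb{P}$ on $\mathbb{R}^p$, a positive semi-definite $\Gamma\in\mathbb{R}^{p\times p}$ and a set of directions $\mathcal{U}\subset S^{p-1}$, the matrix depth of $\Gamma$ with respect to $\mathbb{P}$ relative to $\mathcal{U}$ is $$\mathcal{D}_{\mathcal{U}}(\Gamma,\mathbb{P})=\inf_{u\in\mathcal{U}}\min\left\{\mathbb{P}\{|u^TX|^2\le u^T\Gamma u\},\ \mathbb{P}\{|u^TX|^2\ge u^T\Gamma u\}\right\},\qquad X\sim\mathbb{P}.$$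
   Formalization: Added assumption: some u in U has u^TΣu ≠ 0. Without it the claim fails: for Σ = diag(1,0), U = {e_2} both probabilities are 1, so the depth is 1; for empty U the infimum is not 1/2. Only such false cases are excluded. *)

theory Defs
  imports "HOL-Probability.Probability"
begin

definition pos_semidef :: "real ^ 'n ^ 'n \<Rightarrow> bool" where
  "pos_semidef A \<longleftrightarrow> transpose A = A \<and> (\<forall>x. 0 \<le> x \<bullet> (A *v x))"

lemma pos_semidef_add_axis:
  fixes A :: "real ^ 'n ^ 'n"
  assumes "transpose A = A"
  shows "(x + t *\<^sub>R axis s 1) \<bullet> (A *v (x + t *\<^sub>R axis s 1))
           = x \<bullet> (A *v x) + 2 * t * (A $ s \<bullet> x) + t\<^sup>2 * A $ s $ s"
proof -
  have 1: "axis s 1 \<bullet> (A *v y) = A $ s \<bullet> y" for y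
    by (subst inner_axis') (simp add: matrix_vector_mult_def inner_vec_def)
  have 2: "x \<bullet> (A *v axis s 1) = A $ s \<bullet> x"
    using 1[of x] assms by (metis dot_lmul_matrix inner_commute transpose_matrix_vector)
  have 3: "A $ s \<bullet> axis s 1 = A $ s $ s"
    by (simp add: inner_axis)
  have lin: "A *v (x + t *\<^sub>R axis s 1) = A *v x + t *\<^sub>R (A *v axis s 1)"
    by (simp add: matrix_vector_right_distrib matrix_vector_mult_scaleR)
  show ?thesis
    unfolding lin inner_add_left inner_add_right inner_scaleR_left inner_scaleR_right 1 2 3
    by (simp add: algebra_simps power2_eq_square)
qed

lemma pos_semidef_sum_squares:
  fixes A :: "real ^ 'n ^ 'n"
  assumes "finite S" "pos_semidef A" "\<And>i j. i \<notin> S \<Longrightarrow> A $ i $ j = 0"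
  shows "\<exists>b::'n \<Rightarrow> real ^ 'n. \<forall>i j. A $ i $ j = (\<Sum>k\<in>S. b k $ i * b k $ j)"
  using assms
proof (induction S arbitrary: A rule: finite_induct)
  case empty
  then show ?case by auto
next
  case (insert s S)
  have sym: "transpose A = A" and nn: "\<And>x. 0 \<le> x \<bullet> (A *v x)"
    using insert.prems(1) by (auto simp: pos_semidef_def)
  have symc: "A $ i $ j = A $ j $ i" for i j
    using sym by (metis transpose_def vec_lambda_beta)
  have "0 \<le> A $ s $ s"
    using nn[of "axis s 1"] pos_semidef_add_axis[OF sym, of 0 1 s] by simp
  then consider (zero) "A $ s $ s = 0" | (pos) "0 < A $ s $ s" by linarith
  then show ?case
  proof cases
    case zero
    have "A $ s \<bullet> x = 0" for x
    proof (rule ccontr)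
      let ?c = "A $ s \<bullet> x" and ?q = "x \<bullet> (A *v x)"
      assume c: "?c \<noteq> 0"
      let ?t = "- (?q + 1) / (2 * ?c)"
      have "0 \<le> ?q + 2 * ?t * ?c"
        using nn[of "x + ?t *\<^sub>R axis s 1"] zero
        by (simp only: pos_semidef_add_axis[OF sym])
      then show False using c by (simp add: field_simps)
    qed
    then have row: "A $ s = 0"
      by (metis inner_eq_zero_iff)
    have "\<And>i j. i \<notin> S \<Longrightarrow> A $ i $ j = 0"
      using row insert.prems(2) by (metis insert_iff zero_index)
    then obtain b where b: "\<forall>i j. A $ i $ j = (\<Sum>k\<in>S. b k $ i * b k $ j)"
      using insert.IH[OF insert.prems(1)] by blast
    have "(\<Sum>k\<in>S. (b(s := 0)) k $ i * (b(s := 0)) k $ j) = (\<Sum>k\<in>S. b k $ i * b k $ j)" for i j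
      using insert.hyps by (intro sum.cong) auto
    then show ?thesis
      using b insert.hyps by (intro exI[of _ "b(s := 0)"]) (auto simp del: fun_upd_apply simp: fun_upd_same)
  next
    case pos
    define d where "d = A $ s $ s"
    define B where "B = (\<chi> i j. A $ i $ j - A $ s $ i * A $ s $ j / d)"
    have d: "d > 0" using pos by (simp add: d_def)
    have Bv: "B *v x = A *v x - ((A $ s \<bullet> x) / d) *\<^sub>R (A $ s)" for x
      by (simp add: vec_eq_iff B_def matrix_vector_mult_def inner_vec_def
          sum_divide_distrib sum_distrib_right flip: sum_subtractf)
        (auto intro!: sum.cong simp: algebra_simps)
    have q: "x \<bullet> (B *v x) = x \<bullet> (A *v x) - (A $ s \<bullet> x)\<^sup>2 / d" for x
      unfolding Bv by (simp add: inner_diff_right inner_commute power2_eq_square)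
    have "0 \<le> x \<bullet> (B *v x)" for x
    proof -
      have "0 \<le> x \<bullet> (A *v x) + 2 * (- (A $ s \<bullet> x) / d) * (A $ s \<bullet> x) + (- (A $ s \<bullet> x) / d)\<^sup>2 * d"
        using nn[of "x + (- (A $ s \<bullet> x) / d) *\<^sub>R axis s 1"]
        unfolding pos_semidef_add_axis[OF sym] d_def .
      also have "\<dots> = x \<bullet> (B *v x)"
        unfolding q using d by (simp add: field_simps power2_eq_square)
      finally show ?thesis .
    qed
    moreover have "transpose B = B"
      by (simp add: vec_eq_iff transpose_def B_def symc mult.commute)
    ultimately have psd: "pos_semidef B" by (simp add: pos_semidef_def)
    have "B $ i $ j = 0" if "i \<notin> S" for i j
    proof (cases "i = s")
      case True
      then show ?thesis using d by (simp add: B_def d_def)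
    next
      case False
      then have "A $ i $ j = 0" for j using that insert.prems(2) by auto
      then show ?thesis by (simp add: B_def symc[of s i])
    qed
    then obtain b where b: "\<forall>i j. B $ i $ j = (\<Sum>k\<in>S. b k $ i * b k $ j)"
      using insert.IH[OF psd] by blast
    define b' where "b' = b(s := (1 / sqrt d) *\<^sub>R (A $ s))"
    have "A $ i $ j = (\<Sum>k\<in>insert s S. b' k $ i * b' k $ j)" for i j
    proof -
      have "(\<Sum>k\<in>S. b' k $ i * b' k $ j) = B $ i $ j"
        using insert.hyps b by (auto simp: b'_def intro!: sum.cong)
      moreover have "b' s $ i * b' s $ j = A $ s $ i * A $ s $ j / d"
        using d by (simp add: b'_def)
      ultimately show ?thesis
        using insert.hyps by (simp add: B_def)
    qed
    then show ?thesis by blast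
  qed
qed

definition matrix_factor :: "real ^ 'n ^ 'n \<Rightarrow> real ^ 'n ^ 'n" where
  "matrix_factor \<Sigma> = (SOME A. A ** transpose A = \<Sigma>)"

lemma matrix_factor:
  fixes \<Sigma> :: "real ^ 'n ^ 'n"
  assumes "pos_semidef \<Sigma>"
  shows "matrix_factor \<Sigma> ** transpose (matrix_factor \<Sigma>) = \<Sigma>"
proof -
  obtain b :: "'n \<Rightarrow> real ^ 'n" where "\<forall>i j. \<Sigma> $ i $ j = (\<Sum>k\<in>UNIV. b k $ i * b k $ j)"
    using pos_semidef_sum_squares[of UNIV \<Sigma>] assms by auto
  then have "(\<chi> i k. b k $ i) ** transpose (\<chi> i k. b k $ i) = \<Sigma>"
    by (simp add: vec_eq_iff matrix_matrix_mult_def transpose_def)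
  then show ?thesis unfolding matrix_factor_def by (rule someI)
qed

definition std_normal_vec :: "(real ^ 'n) measure" where
  "std_normal_vec = distr (\<Pi>\<^sub>M i\<in>UNIV. std_normal_distribution) borel (\<lambda>z. \<chi> i. z i)"

(* N(\<mu>, \<Sigma>) is the law of \<mu> + A Z, where Z has independent N(0, 1) coordinates and
   A A^T = \<Sigma>. The law does not depend on which factor A is chosen, and singular \<Sigma>
   are allowed. Meaningful only for positive semi-definite \<Sigma>. *)
definition normal_vec :: "real ^ 'n \<Rightarrow> real ^ 'n ^ 'n \<Rightarrow> (real ^ 'n) measure" where
  "normal_vec \<mu> \<Sigma> = distr std_normal_vec borel (\<lambda>z. \<mu> + matrix_factor \<Sigma> *v z)"

(* The infimum is that of the reals, so the value for U = {} is unspecified. *)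
definition matrix_depth :: "(real ^ 'n) set \<Rightarrow> real ^ 'n ^ 'n \<Rightarrow> (real ^ 'n) measure \<Rightarrow> real" where
  "matrix_depth U \<Gamma> P =
     (INF u\<in>U. min (\<P>(x in P. \<bar>u \<bullet> x\<bar>\<^sup>2 \<le> u \<bullet> (\<Gamma> *v u)))
                   (\<P>(x in P. \<bar>u \<bullet> x\<bar>\<^sup>2 \<ge> u \<bullet> (\<Gamma> *v u))))"

end

theory Submission
  imports Defs
begin

text \<open>
  The idea is that the depth is computed one direction at a time, and in each direction only the
  law of the scalar \<open>u \<bullet> X\<close> matters. Writing \<open>X = A Z\<close> with \<open>A A\<^sup>T = \<Sigma>\<close> and \<open>Z\<close> standard normal,
  \<open>u \<bullet> X = (A\<^sup>T u) \<bullet> Z\<close> and \<open>u \<bullet> \<Sigma> u = \<parallel>A\<^sup>T u\<parallel>\<^sup>2\<close>, so there are two kinds of directions.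

  If \<open>A\<^sup>T u \<noteq> 0\<close>, then \<open>u \<bullet> X / \<parallel>A\<^sup>T u\<parallel>\<close> is a standard normal variable \<open>T\<close>
  (lemma \<open>std_normal_vec_projection\<close>), and the two events become \<open>\<bar>T\<bar> \<le> \<surd>\<beta>\<close> and \<open>\<bar>T\<bar> \<ge> \<surd>\<beta>\<close>.
  By symmetry and absence of atoms they have probabilities \<open>2 \<Phi>(\<surd>\<beta>) - 1\<close> and \<open>2 - 2 \<Phi>(\<surd>\<beta>)\<close>; the
  equation \<open>\<Phi>(\<surd>\<beta>) = 3/4\<close> says precisely that both are \<open>1/2\<close>, that is, \<open>\<surd>\<beta>\<close> is the median
  of \<open>\<bar>T\<bar>\<close>.

  If \<open>A\<^sup>T u = 0\<close>, both sides of the two inequalities vanish identically, and both probabilities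
  are \<open>1\<close>. Such directions never lower the infimum below \<open>1/2\<close>, and a direction of the first kind
  attains it.
\<close>

section \<open>The absolute value of a standard normal variable\<close>

interpretation std_normal: real_distribution std_normal_distribution
  by (rule real_dist_normal_dist)

lemma std_normal_singleton: "measure std_normal_distribution {a} = 0"
proof -
  have "emeasure std_normal_distribution {a} = 0"
    by (subst emeasure_density)
       (auto intro!: nn_integral_null_set simp: null_sets_def)
  then show ?thesis by (simp add: measure_def)
qed

text \<open>Reflection is the affine map with slope \<open>-1\<close>, under which centred normal laws are stable.\<close>

lemma std_normal_reflect:
  "distr std_normal_distribution borel uminus = std_normal_distribution"
proof -
  have "distributed std_normal_distribution lborel (\<lambda>x. x) (normal_density 0 1)"
    by (auto simp: distributed_def intro!: distr_id2)
  from std_normal.normal_density_affine[OF this, of "-1" 0]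
  have "distr std_normal_distribution lborel uminus = std_normal_distribution"
    by (simp add: distributed_def)
  then show ?thesis by (metis distr_cong sets_lborel)
qed

lemma std_normal_atMost_minus:
  "measure std_normal_distribution {..- c} = 1 - cdf std_normal_distribution c"
proof -
  have "measure std_normal_distribution {..- c}
          = measure (distr std_normal_distribution borel uminus) {..- c}"
    by (simp add: std_normal_reflect)
  also have "\<dots> = measure std_normal_distribution {c..}"
    by (subst measure_distr) (auto intro!: arg_cong[where f = "measure _"])
  also have "\<dots> = measure std_normal_distribution ({c} \<union> {c<..})"
    by (intro arg_cong[where f = "measure _"]) auto
  also have "\<dots> = measure std_normal_distribution {c<..}"
    by (subst std_normal.finite_measure_Union) (auto simp: std_normal_singleton)
  also have "{c<..} = space std_normal_distribution - {..c}" by auto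
  also have "measure std_normal_distribution \<dots> = 1 - cdf std_normal_distribution c"
    by (subst std_normal.prob_compl) (auto simp: cdf_def)
  finally show ?thesis .
qed

lemma std_normal_cdf_0: "cdf std_normal_distribution 0 = 1 / 2"
  using std_normal_atMost_minus[of 0] by (simp add: cdf_def)

lemma std_normal_abs_le:
  assumes "0 \<le> c"
  shows "measure std_normal_distribution {x. \<bar>x\<bar> \<le> c} = 2 * cdf std_normal_distribution c - 1"
proof -
  have "cdf std_normal_distribution c
          = measure std_normal_distribution ({x. \<bar>x\<bar> \<le> c} \<union> {..<- c})"
    unfolding cdf_def using assms by (intro arg_cong[where f = "measure _"]) auto
  also have "\<dots> = measure std_normal_distribution {x. \<bar>x\<bar> \<le> c}
                    + measure std_normal_distribution {..<- c}"
    by (subst std_normal.finite_measure_Union) auto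
  also have "measure std_normal_distribution {..<- c}
               = measure std_normal_distribution ({..<- c} \<union> {- c})"
    by (subst std_normal.finite_measure_Union) (auto simp: std_normal_singleton)
  also have "{..<- c} \<union> {- c} = {..- c}" by auto
  finally show ?thesis by (simp add: std_normal_atMost_minus)
qed

lemma std_normal_abs_ge:
  assumes "0 < c"
  shows "measure std_normal_distribution {x. c \<le> \<bar>x\<bar>} = 2 - 2 * cdf std_normal_distribution c"
proof -
  have "measure std_normal_distribution {x. \<bar>x\<bar> \<le> c}
          = measure std_normal_distribution ({x. \<bar>x\<bar> < c} \<union> {- c, c})"
    using assms by (intro arg_cong[where f = "measure _"]) auto
  also have "\<dots> = measure std_normal_distribution {x. \<bar>x\<bar> < c}"
  proof -
    have "measure std_normal_distribution ({- c} \<union> {c}) = 0"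
      using assms by (subst std_normal.finite_measure_Union) (auto simp: std_normal_singleton)
    then show ?thesis
      by (subst std_normal.finite_measure_Union) (auto simp: insert_commute)
  qed
  finally have "measure std_normal_distribution {x. \<bar>x\<bar> < c} = 2 * cdf std_normal_distribution c - 1"
    using std_normal_abs_le[of c] assms by simp
  moreover have "{x. c \<le> \<bar>x\<bar>} = space std_normal_distribution - {x. \<bar>x\<bar> < c}" by auto
  ultimately show ?thesis
    by (simp only:) (subst std_normal.prob_compl, auto)
qed

section \<open>One-dimensional projections of a normal vector\<close>

lemma vec_lambda_measurable:
  "(\<lambda>z. \<chi> i. z i) \<in> (\<Pi>\<^sub>M i\<in>(UNIV :: 'n::finite set). std_normal_distribution) \<rightarrow>\<^sub>M (borel :: (real ^ 'n) measure)"
  by (subst borel_measurable_euclidean_space) (auto simp: Basis_vec_def inner_axis)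

text \<open>
  The inner product is a sum of independent centred normal variables, and the squares of their
  deviations add up to \<open>\<parallel>w\<parallel>\<^sup>2\<close>.
\<close>

lemma std_normal_vec_projection:
  fixes w :: "real ^ 'n"
  assumes "w \<noteq> 0"
  shows "distr std_normal_vec borel (\<lambda>z. (w \<bullet> z) / norm w) = std_normal_distribution"
proof -
  let ?P = "\<Pi>\<^sub>M i\<in>(UNIV :: 'n set). std_normal_distribution"
  interpret P: prob_space ?P
    by (intro prob_space_PiM) (rule std_normal.prob_space_axioms)
  have comp: "distr ?P borel (\<lambda>z. z i) = std_normal_distribution" for i
  proof -
    have "distr ?P borel (\<lambda>z. z i) = distr ?P std_normal_distribution (\<lambda>z. z i)"
      by (rule distr_cong) auto
    also have "\<dots> = std_normal_distribution"
      by (rule distr_PiM_component) (auto intro: std_normal.prob_space_axioms)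
    finally show ?thesis .
  qed
  have indep: "P.indep_vars (\<lambda>_. borel) (\<lambda>i z. z i) UNIV"
  proof (subst P.indep_vars_iff_distr_eq_PiM)
    have "distr ?P (\<Pi>\<^sub>M i\<in>UNIV. borel) (\<lambda>x. \<lambda>i\<in>UNIV. x i) = ?P"
      unfolding restrict_UNIV by (rule distr_id2) (auto intro!: sets_PiM_cong)
    then show "distr ?P (\<Pi>\<^sub>M i\<in>UNIV. borel) (\<lambda>x. \<lambda>i\<in>UNIV. x i)
                 = (\<Pi>\<^sub>M i\<in>UNIV. distr ?P borel (\<lambda>z. z i))"
      by (simp only: comp)
  qed auto
  \<comment> \<open>A vanishing coefficient contributes a degenerate summand, which has no density,
      so the sum is taken over the support of \<open>w\<close>.\<close>
  define I where "I = {i. w $ i \<noteq> 0}"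
  have "P.indep_vars (\<lambda>_. borel) (\<lambda>i z. w $ i * z i) I"
    by (rule P.indep_vars_compose2[OF P.indep_vars_subset[OF indep]]) auto
  moreover have "distributed ?P lborel (\<lambda>z. w $ i * z i) (normal_density 0 \<bar>w $ i\<bar>)"
    if "i \<in> I" for i
  proof -
    have "distr ?P lborel (\<lambda>z. z i) = distr ?P borel (\<lambda>z. z i)"
      by (rule distr_cong) auto
    then have "distributed ?P lborel (\<lambda>z. z i) (normal_density 0 1)"
      by (auto simp: distributed_def comp)
    from P.normal_density_affine[OF this, of "w $ i" 0] that show ?thesis
      by (simp add: I_def)
  qed
  moreover have "I \<noteq> {}" using assms by (auto simp: I_def vec_eq_iff)
  ultimately have "distributed ?P lborel (\<lambda>z. \<Sum>i\<in>I. w $ i * z i)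
      (normal_density (\<Sum>i\<in>I. 0) (sqrt (\<Sum>i\<in>I. \<bar>w $ i\<bar>\<^sup>2)))"
    by (intro P.sum_indep_normal) (auto simp: I_def)
  moreover have "(\<Sum>i\<in>I. w $ i * z i) = w \<bullet> (\<chi> i. z i)" for z
    unfolding inner_vec_def by (rule sum.mono_neutral_cong_left) (auto simp: I_def)
  moreover have "sqrt (\<Sum>i\<in>I. \<bar>w $ i\<bar>\<^sup>2) = norm w"
    unfolding norm_vec_def L2_set_def
    by (intro arg_cong[where f = sqrt] sum.mono_neutral_cong_left) (auto simp: I_def)
  ultimately have "distributed ?P lborel (\<lambda>z. w \<bullet> (\<chi> i. z i)) (normal_density 0 (norm w))"
    by simp
  then have "distributed ?P lborel (\<lambda>z. w \<bullet> (\<chi> i. z i) / norm w) std_normal_density"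
    using assms by (subst (asm) P.normal_standard_normal_convert) auto
  then have "distr ?P lborel (\<lambda>z. w \<bullet> (\<chi> i. z i) / norm w) = std_normal_distribution"
    by (simp add: distributed_def)
  moreover have "distr ?P lborel (\<lambda>z. w \<bullet> (\<chi> i. z i) / norm w)
      = distr ?P borel (\<lambda>z. w \<bullet> (\<chi> i. z i) / norm w)"
    by (rule distr_cong) auto
  moreover have "distr std_normal_vec borel (\<lambda>z. (w \<bullet> z) / norm w)
      = distr ?P borel (\<lambda>z. w \<bullet> (\<chi> i. z i) / norm w)"
    unfolding std_normal_vec_def
    by (subst distr_distr[OF _ vec_lambda_measurable]) (auto simp: o_def)
  ultimately show ?thesis by simp
qed

lemma prob_space_std_normal_vec: "prob_space (std_normal_vec :: (real ^ 'n) measure)"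
  unfolding std_normal_vec_def
  by (intro prob_space.prob_space_distr vec_lambda_measurable prob_space_PiM)
     (rule std_normal.prob_space_axioms)

lemma quadratic_form_factor:
  assumes "pos_semidef \<Sigma>"
  shows "u \<bullet> (\<Sigma> *v u) = (norm (transpose (matrix_factor \<Sigma>) *v u))\<^sup>2"
proof -
  let ?A = "matrix_factor \<Sigma>"
  have "u \<bullet> (\<Sigma> *v u) = u \<bullet> (?A *v (transpose ?A *v u))"
    by (simp only: matrix_factor[OF assms] matrix_vector_mul_assoc)
  then show ?thesis
    by (simp add: power2_norm_eq_inner flip: dot_lmul_matrix transpose_matrix_vector)
qed

text \<open>
  This is \<open>u \<bullet> (A z) = (A\<^sup>T u) \<bullet> z\<close>. It includes the directions with \<open>A\<^sup>T u = 0\<close>, in which the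
  projection is almost surely \<open>0\<close>.
\<close>

lemma normal_vec_projection_prob:
  fixes \<Sigma> :: "real ^ 'n ^ 'n"
  assumes "B \<in> sets borel"
  shows "\<P>(x in normal_vec 0 \<Sigma>. u \<bullet> x \<in> B)
           = \<P>(z in std_normal_vec. (transpose (matrix_factor \<Sigma>) *v u) \<bullet> z \<in> B)"
proof -
  let ?A = "matrix_factor \<Sigma>"
  have sets: "sets (std_normal_vec :: (real ^ 'n) measure) = sets borel"
    and space: "space (std_normal_vec :: (real ^ 'n) measure) = UNIV"
    by (simp_all add: std_normal_vec_def)
  have "continuous_on UNIV (\<lambda>z :: real ^ 'n. 0 + ?A *v z)"
    by (intro continuous_intros matrix_vector_mult_linear_continuous_on)
  then have meas: "(\<lambda>z :: real ^ 'n. 0 + ?A *v z) \<in> std_normal_vec \<rightarrow>\<^sub>M borel"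
    by (subst measurable_cong_sets[OF sets refl]) (rule borel_measurable_continuous_onI)
  have B: "{x. u \<bullet> x \<in> B} \<in> sets borel"
    using assms by measurable
  have eq: "u \<bullet> (?A *v z) = (transpose ?A *v u) \<bullet> z" for z
    by (simp add: dot_lmul_matrix transpose_matrix_vector)
  have "\<P>(x in normal_vec 0 \<Sigma>. u \<bullet> x \<in> B) = measure (normal_vec 0 \<Sigma>) {x. u \<bullet> x \<in> B}"
    by (simp add: normal_vec_def)
  also have "\<dots> = measure std_normal_vec {z. u \<bullet> (?A *v z) \<in> B}"
    unfolding normal_vec_def using B
    by (subst measure_distr[OF meas]) (auto simp: space vimage_def)
  finally show ?thesis by (simp add: eq space)
qed

section \<open>The depth\<close>

text \<open>
  After division by the standard deviation, the event only constrains the absolute value of a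
  standard normal variable.
\<close>

lemma normal_vec_direction_prob:
  fixes \<Sigma> :: "real ^ 'n ^ 'n"
  assumes \<Sigma>: "pos_semidef \<Sigma>" and u: "u \<bullet> (\<Sigma> *v u) \<noteq> 0" and \<beta>: "0 \<le> \<beta>"
  shows "\<P>(x in normal_vec 0 \<Sigma>. \<bar>u \<bullet> x\<bar>\<^sup>2 \<le> u \<bullet> ((\<beta> *\<^sub>R \<Sigma>) *v u))
           = measure std_normal_distribution {t. \<bar>t\<bar> \<le> sqrt \<beta>}" (is ?le)
    and "\<P>(x in normal_vec 0 \<Sigma>. \<bar>u \<bullet> x\<bar>\<^sup>2 \<ge> u \<bullet> ((\<beta> *\<^sub>R \<Sigma>) *v u))
           = measure std_normal_distribution {t. sqrt \<beta> \<le> \<bar>t\<bar>}" (is ?ge)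
proof -
  define w where "w = transpose (matrix_factor \<Sigma>) *v u"
  have w: "norm w > 0" and q: "u \<bullet> ((\<beta> *\<^sub>R \<Sigma>) *v u) = (sqrt \<beta> * norm w)\<^sup>2"
    using u \<beta> by (auto simp: quadratic_form_factor[OF \<Sigma>] w_def scaleR_matrix_vector_assoc[symmetric]
        power_mult_distrib)
  have sets: "sets (std_normal_vec :: (real ^ 'n) measure) = sets borel"
    and space: "space (std_normal_vec :: (real ^ 'n) measure) = UNIV"
    by (simp_all add: std_normal_vec_def)
  have pr: "\<P>(x in normal_vec 0 \<Sigma>. u \<bullet> x \<in> (\<lambda>r. r / norm w) -` T)
          = measure std_normal_distribution T" if T[measurable]: "T \<in> sets borel" for T
  proof -
    have meas: "(\<lambda>z. w \<bullet> z / norm w) \<in> std_normal_vec \<rightarrow>\<^sub>M borel"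
      by (subst measurable_cong_sets[OF sets refl]) measurable
    have "(\<lambda>r. r / norm w) -` T \<in> sets borel"
      using measurable_sets[of "\<lambda>r. r / norm w" borel borel T] T by simp
    then have "\<P>(x in normal_vec 0 \<Sigma>. u \<bullet> x \<in> (\<lambda>r. r / norm w) -` T)
        = measure std_normal_vec {z. w \<bullet> z / norm w \<in> T}"
      by (subst normal_vec_projection_prob) (auto simp: w_def space)
    also have "\<dots> = measure (distr std_normal_vec borel (\<lambda>z. w \<bullet> z / norm w)) T"
      by (subst measure_distr[OF meas T]) (simp add: space vimage_def)
    finally show ?thesis
      using w by (simp add: std_normal_vec_projection)
  qed
  have nn: "0 \<le> sqrt \<beta> * norm w" using \<beta> by simp
  have "\<bar>r\<bar>\<^sup>2 \<le> u \<bullet> ((\<beta> *\<^sub>R \<Sigma>) *v u) \<longleftrightarrow> r \<in> (\<lambda>r. r / norm w) -` {t. \<bar>t\<bar> \<le> sqrt \<beta>}" for r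
    unfolding q power_mono_iff[OF abs_ge_zero nn, of 2, simplified] abs_le_square_iff[symmetric]
    using w nn by (simp add: pos_divide_le_eq)
  then show ?le using pr[of "{t. \<bar>t\<bar> \<le> sqrt \<beta>}"] by simp
  have "\<bar>r\<bar>\<^sup>2 \<ge> u \<bullet> ((\<beta> *\<^sub>R \<Sigma>) *v u) \<longleftrightarrow> r \<in> (\<lambda>r. r / norm w) -` {t. sqrt \<beta> \<le> \<bar>t\<bar>}" for r
    unfolding q power_mono_iff[OF nn abs_ge_zero, of 2, simplified] abs_le_square_iff[symmetric]
    using w nn by (simp add: pos_le_divide_eq)
  then show ?ge using pr[of "{t. sqrt \<beta> \<le> \<bar>t\<bar>}"] by simp
qed

lemma normal_vec_degenerate_direction_prob:
  assumes \<Sigma>: "pos_semidef \<Sigma>" and u: "u \<bullet> (\<Sigma> *v u) = 0"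
  shows "\<P>(x in normal_vec 0 \<Sigma>. u \<bullet> x = 0) = 1"
proof -
  have "transpose (matrix_factor \<Sigma>) *v u = 0"
    using u by (simp add: quadratic_form_factor[OF \<Sigma>])
  then show ?thesis
    using normal_vec_projection_prob[of "{0}" \<Sigma> u]
      prob_space.prob_space[OF prob_space_std_normal_vec] by simp
qed

theorem proposition3p1:
  fixes \<Sigma> :: "real ^ 'p ^ 'p" and \<beta> :: real and U :: "(real ^ 'p) set"
  assumes "pos_semidef \<Sigma>"
    and "\<Sigma> \<noteq> 0"
    and "cdf std_normal_distribution (sqrt \<beta>) = 3 / 4"
    and "U \<subseteq> sphere 0 1"
    and "\<exists>u\<in>U. u \<bullet> (\<Sigma> *v u) \<noteq> 0"
  shows "matrix_depth U (\<beta> *\<^sub>R \<Sigma>) (normal_vec 0 \<Sigma>) = 1 / 2"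
proof -
  \<comment> \<open>Since \<open>\<Phi>(0) = 1/2 < 3/4\<close> and \<open>\<Phi>\<close> is monotone, the root is positive. The square root
      of a negative real is the negated root of its absolute value, so this settles the sign
      of \<open>\<beta>\<close> as well.\<close>
  have pos: "0 < sqrt \<beta>"
    using std_normal.cdf_nondecreasing[of "sqrt \<beta>" 0] std_normal_cdf_0 assms(3)
    by (cases "0 < sqrt \<beta>") auto
  then have \<beta>: "0 \<le> \<beta>" by simp
  define f where "f u = min (\<P>(x in normal_vec 0 \<Sigma>. \<bar>u \<bullet> x\<bar>\<^sup>2 \<le> u \<bullet> ((\<beta> *\<^sub>R \<Sigma>) *v u)))
                   (\<P>(x in normal_vec 0 \<Sigma>. \<bar>u \<bullet> x\<bar>\<^sup>2 \<ge> u \<bullet> ((\<beta> *\<^sub>R \<Sigma>) *v u)))" for u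
  have nondegenerate: "f u = 1 / 2" if "u \<bullet> (\<Sigma> *v u) \<noteq> 0" for u
    unfolding f_def normal_vec_direction_prob[OF assms(1) that \<beta>]
    using std_normal_abs_le[of "sqrt \<beta>"] std_normal_abs_ge[OF pos] \<beta> assms(3) by simp
  have degenerate: "f u = 1" if "u \<bullet> (\<Sigma> *v u) = 0" for u
  proof -
    have "u \<bullet> ((\<beta> *\<^sub>R \<Sigma>) *v u) = 0"
      using that by (simp add: scaleR_matrix_vector_assoc[symmetric])
    moreover have "\<P>(x in normal_vec 0 \<Sigma>. \<bar>u \<bullet> x\<bar>\<^sup>2 \<ge> 0) = 1"
      using normal_vec_projection_prob[of UNIV \<Sigma> u]
        prob_space.prob_space[OF prob_space_std_normal_vec] by simp
    ultimately show ?thesis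
      using normal_vec_degenerate_direction_prob[OF assms(1) that] by (simp add: f_def)
  qed
  obtain v where v: "v \<in> U" "v \<bullet> (\<Sigma> *v v) \<noteq> 0" using assms(5) by blast
  have "Inf (f ` U) = 1 / 2"
  proof (rule cInf_eq_minimum)
    show "1 / 2 \<in> f ` U" using v nondegenerate by (metis imageI)
    show "1 / 2 \<le> y" if "y \<in> f ` U" for y
    proof -
      obtain u where "y = f u" using \<open>y \<in> f ` U\<close> by blast
      then show ?thesis
        using nondegenerate[of u] degenerate[of u] by (cases "u \<bullet> (\<Sigma> *v u) = 0") auto
    qed
  qed
  then show ?thesis unfolding matrix_depth_def f_def .
qed

end
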